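(* Let $d\geq 2$ be an integer and set $\alpha=2(1-2^{-d})$ and $\beta=d-\frac{4}{3}(1-2^{-d})$. There is a constant $C_d>0$, depending only on $d$, such that the following holds for every $N$ and every strictly convex sequence $\{b_i\}_{i=1}^N$ of real numbers. Let $\mathcal B=\{b_1,\dots,b_N\}$, let $\mathcal C_d=\{b_{i_1}+\dots+b_{i_d}: (i_1,\dots,i_d)\in\{1,\dots,N\}^d\}$ (as a set), and for $c\in\mathcal C_d$ let $$\nu(c)=\frac{|\{(i_1,\dots,i_d)\in\{1,\dots,N\}^d: b_{i_1}+\dots+b_{i_d}=c\}|}{d!}.$$ Enumerate $\mathcal C_d=\{c_1,c_2,\dots\}$ so that $\nu(c_1)\geq\nu(c_2)\geq\cdots$. Let $\mathfrak N_d$ denote the number of solutions $(i_1,\dots,i_{2d})\in\{1,\dots,N\}^{2d}$ of $$b_{i_1}+\dots+b_{i_d}=b_{i_{d+1}}+\dots+b_{i_{2d}}.$$ Then (i) $|\mathcal C_d|\geq C_d^{-1}N^{\alpha}$; (ii) $\nu(c_t)\leq C_d\, N^{\beta}t^{-1/3}$ for every $t\geq 1$ with $t\le |\mathcal C_d|$; (iii) $\mathfrak N_d\leq C_d\, N^{2d-\alpha}=C_d N^{2d-2+2^{-d+1}}$.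
   Context: A finite sequence $\{b_i\}_{i=1}^N$ of real numbers is called strictly convex if there is a strictly convex function $f:\mathbb R\to\mathbb R$ with $f(i)=b_i$ for all $i$, i.e. the points $(i,b_i)$ lie on a strictly convex curve. The constants in the estimates do not depend on the specific sequence or on $f$, only on $d$. *)

theory Defs
  imports "HOL-Analysis.Analysis"
begin

definition strictly_convex_on :: "'a::real_vector set \<Rightarrow> ('a \<Rightarrow> real) \<Rightarrow> bool" where
  "strictly_convex_on S f \<longleftrightarrow> convex S \<and>
     (\<forall>x\<in>S. \<forall>y\<in>S. \<forall>u>0. \<forall>v>0. x \<noteq> y \<longrightarrow> u + v = 1 \<longrightarrow>
        f (u *\<^sub>R x + v *\<^sub>R y) < u * f x + v * f y)"

(* A finite sequence is a function on nat of which only the values at 1, ..., N are used. *)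
definition strictly_convex_seq :: "nat \<Rightarrow> (nat \<Rightarrow> real) \<Rightarrow> bool" where
  "strictly_convex_seq N b \<longleftrightarrow>
     (\<exists>f::real \<Rightarrow> real. strictly_convex_on UNIV f \<and> (\<forall>i\<in>{1..N}. f (real i) = b i))"

(* k-tuples (i_1, ..., i_k) with entries in {1, ..., N}; the extensional function space makes
   equality of tuples coincide with equality of functions, so that card counts correctly. *)
definition tuples :: "nat \<Rightarrow> nat \<Rightarrow> (nat \<Rightarrow> nat) set" where
  "tuples k N = {1..k} \<rightarrow>\<^sub>E {1..N}"

definition sumset :: "nat \<Rightarrow> nat \<Rightarrow> (nat \<Rightarrow> real) \<Rightarrow> real set" where
  "sumset d N b = {\<Sum>k=1..d. b (i k) | i. i \<in> tuples d N}"

definition \<nu> :: "nat \<Rightarrow> nat \<Rightarrow> (nat \<Rightarrow> real) \<Rightarrow> real \<Rightarrow> real" where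
  "\<nu> d N b c = real (card {i \<in> tuples d N. (\<Sum>k=1..d. b (i k)) = c}) / fact d"

definition decreasing_enumeration ::
    "nat \<Rightarrow> nat \<Rightarrow> (nat \<Rightarrow> real) \<Rightarrow> (nat \<Rightarrow> real) \<Rightarrow> bool" where
  "decreasing_enumeration d N b c \<longleftrightarrow>
     bij_betw c {1..card (sumset d N b)} (sumset d N b) \<and>
     (\<forall>s t. 1 \<le> s \<and> s \<le> t \<and> t \<le> card (sumset d N b) \<longrightarrow> \<nu> d N b (c s) \<ge> \<nu> d N b (c t))"

definition solution_count :: "nat \<Rightarrow> nat \<Rightarrow> (nat \<Rightarrow> real) \<Rightarrow> nat" where
  "solution_count d N b =
     card {i \<in> tuples (2 * d) N. (\<Sum>k=1..d. b (i k)) = (\<Sum>k=d+1..2*d. b (i k))}"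

definition \<alpha> :: "nat \<Rightarrow> real" where
  "\<alpha> d = 2 * (1 - 2 powr (- real d))"

definition \<beta> :: "nat \<Rightarrow> real" where
  "\<beta> d = real d - 4 / 3 * (1 - 2 powr (- real d))"

end

theory Submission
  imports Defs
begin

text \<open>
  The incidence bound behind the theorem is elementary. Suppose many \<open>i\<close> satisfy \<open>c - b i \<in> A\<close>. On a
  range where \<open>b\<close> is monotone the points \<open>(i, c - b i)\<close> form a monotone chain, which visits few cells
  of a grid cut both in the index and in the rank within \<open>A\<close>; so many pairs \<open>i < i + h\<close> share a cell,
  with \<open>h\<close> small and \<open>a = c - b i\<close>, \<open>a' = c - b (i + h)\<close> close in \<open>A\<close>. By strict convexity
  \<open>(h, a, a')\<close> determines \<open>i\<close> and hence \<open>c\<close>. Counting these triples bounds the number of \<open>c\<close> with at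
  least \<open>k\<close> representations by a constant times \<open>N |A|\<^sup>2 / k\<^sup>3\<close>.

  Decomposing the representation function of \<open>d\<close>-fold sums dyadically and applying this to each
  level set gives, by induction on \<open>d\<close> from \<open>d = 0\<close>, the weak \<open>L\<^sup>3\<close> estimate equivalent to (ii):
  levels above \<open>N powr (d - \<alpha> d)\<close> are bounded with the inductive estimate, levels below with the total
  mass \<open>N ^ d\<close>, and both series are geometric. The same splitting gives (iii), and Cauchy--Schwarz
  gives (i).
\<close>

subsection \<open>Translates of a convex sequence rich in a given set\<close>

text \<open>Removing the larger member of every colliding pair leaves a set on which
  \<open>g\<close> is injective. This linear collision count suffices below, where the cells number
  at most \<open>k / 2\<close>.\<close>

lemma card_le_card_image_plus_pairs:
  fixes g :: "'a::linorder \<Rightarrow> 'b"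
  assumes "finite S"
  shows "card S \<le> card (g ` S) + card {(i, j). i \<in> S \<and> j \<in> S \<and> i < j \<and> g i = g j}"
proof -
  let ?Q = "{(i, j). i \<in> S \<and> j \<in> S \<and> i < j \<and> g i = g j}"
  let ?R = "S - snd ` ?Q"
  have fin: "finite ?Q"
    by (rule finite_subset[of _ "S \<times> S"]) (use assms in auto)
  have "inj_on g ?R"
  proof (rule inj_onI, rule ccontr)
    fix x y assume xy: "x \<in> ?R" "y \<in> ?R" "g x = g y" "x \<noteq> y"
    then have "(x, y) \<in> ?Q \<or> (y, x) \<in> ?Q"
      by auto
    then show False
      using xy by force
  qed
  then have "card ?R = card (g ` ?R)"
    by (simp add: card_image)
  also have "\<dots> \<le> card (g ` S)"
    using assms by (intro card_mono) auto
  finally have 1: "card ?R \<le> card (g ` S)" .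
  have "card S \<le> card (?R \<union> snd ` ?Q)"
    using assms fin by (intro card_mono) auto
  also have "\<dots> \<le> card ?R + card (snd ` ?Q)"
    by (rule card_Un_le)
  also have "card (snd ` ?Q) \<le> card ?Q"
    by (rule card_image_le[OF fin])
  finally show ?thesis
    using 1 by linarith
qed

lemma card_div_fibre_le:
  fixes L :: nat
  assumes "L > 0" "inj_on v A"
  shows "card {a\<in>A. v a div L = q} \<le> L"
proof -
  have "card {a\<in>A. v a div L = q} = card (v ` {a\<in>A. v a div L = q})"
    by (rule card_image[symmetric]) (use assms(2) in \<open>auto intro: inj_on_subset\<close>)
  also have "\<dots> \<le> card {q * L..<q * L + L}"
  proof (rule card_mono)
    show "v ` {a \<in> A. v a div L = q} \<subseteq> {q * L..<q * L + L}"
      using \<open>L > 0\<close> by (auto simp: dividend_less_times_div div_times_less_eq_dividend)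
        (metis add.commute dividend_less_times_div mult.commute)
  qed simp
  finally show ?thesis by simp
qed

text \<open>As \<open>b\<close> decreases on \<open>J\<close>, the chain \<open>(i, c - b i)\<close>
  increases. Cells with sides about \<open>N / k\<close> and \<open>card A / k\<close> force
  \<open>k / 2\<close> collisions for each rich \<open>c\<close>, whereas only
  \<open>L1 * card A * L2\<close> triples are available.\<close>

lemma rich_translates_antimono:
  fixes b :: "nat \<Rightarrow> real"
  assumes J: "J \<subseteq> {1..N}"
    and anti: "\<And>i j. i \<in> J \<Longrightarrow> j \<in> J \<Longrightarrow> i < j \<Longrightarrow> b j < b i"
    and diff: "\<And>i j h. 0 < h \<Longrightarrow> i \<in> J \<Longrightarrow> i + h \<in> J \<Longrightarrow> j \<in> J \<Longrightarrow> j + h \<in> J \<Longrightarrow>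
                 b (i + h) - b i = b (j + h) - b j \<Longrightarrow> i = j"
    and A: "finite A" and k: "k > 0"
  shows "real (card {c. k \<le> real (card {i\<in>J. c - b i \<in> A})}) * k ^ 3
           \<le> 162 * real N * real (card A) ^ 2"
proof -
  define S where "S c = {i\<in>J. c - b i \<in> A}" for c
  define T where "T = {c. k \<le> real (card (S c))}"
  define n where "n = card A"
  have finJ: "finite J"
    using J finite_subset by blast
  have finS: "finite (S c)" for c
    using finJ by (simp add: S_def)
  have "T \<subseteq> (\<lambda>(a, i). a + b i) ` (A \<times> J)"
  proof
    fix c assume "c \<in> T"
    then have "S c \<noteq> {}"
      using k by (auto simp: T_def)
    then obtain i where "i \<in> J" "c - b i \<in> A"
      by (auto simp: S_def)
    then show "c \<in> (\<lambda>(a, i). a + b i) ` (A \<times> J)"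
      by (intro image_eqI[of _ _ "(c - b i, i)"]) auto
  qed
  then have finT: "finite T" and "card T \<le> card (A \<times> J)"
    using A finJ finite_cartesian_product[of A J] by (blast intro: finite_subset, blast intro: surj_card_le)
  moreover have "card J \<le> N"
    using card_mono[OF _ J] by simp
  ultimately have cardT: "card T \<le> n * N"
    by (metis n_def card_cartesian_product le_trans mult_le_mono2)
  have goal: "real (card T) * k ^ 3 \<le> 162 * real N * real n ^ 2"
  proof (cases "T = {}")
    case True
    then show ?thesis by simp
  next
    case False
    then obtain c0 where c0: "k \<le> real (card (S c0))"
      by (auto simp: T_def)
    have "card (S c0) \<le> card J"
      using finJ by (intro card_mono) (auto simp: S_def)
    with c0 \<open>card J \<le> N\<close> have kN: "k \<le> real N"
      by linarith
    have injb: "inj_on b J"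
      by (rule inj_onI) (metis anti less_irrefl linorder_neqE_nat)
    have "card (S c0) = card ((\<lambda>i. c0 - b i) ` S c0)"
      using injb by (intro card_image[symmetric]) (auto simp: inj_on_def S_def)
    also have "\<dots> \<le> n"
      unfolding n_def using A by (intro card_mono) (auto simp: S_def)
    finally have kn: "k \<le> real n"
      using c0 by linarith
    have npos: "real n \<ge> 1"
      using kn k by (cases n) auto
    \<comment> \<open>The cell count carries an extra 1, and \<open>k / 4 + 1 \<le> k / 2\<close>
      needs \<open>k \<ge> 4\<close>. For smaller \<open>k\<close> the trivial bound on
      \<open>card T\<close> is enough because \<open>4 ^ 3 \<le> 162\<close>.\<close>
    show ?thesis
    proof (cases "k < 4")
      case True
      have "real (card T) * k ^ 3 \<le> real (n * N) * 4 ^ 3"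
        using cardT True k by (intro mult_mono power_mono) (auto simp del: of_nat_mult)
      also have "\<dots> \<le> 162 * real N * (real n * 1)"
        by simp
      also have "\<dots> \<le> 162 * real N * (real n * real n)"
        using npos by (intro mult_left_mono) auto
      finally show ?thesis
        by (simp add: power2_eq_square)
    next
      case False
      then have k4: "k \<ge> 4" by simp
      \<comment> \<open>The 8 keeps \<open>N div L1\<close> and \<open>n div L2\<close> below
        \<open>k / 8\<close>. Rounding up costs at most 1, absorbed through \<open>k \<le> N\<close>
        and \<open>k \<le> n\<close>; hence the 9.\<close>
      define L1 where "L1 = nat \<lceil>8 * real N / k\<rceil>"
      define L2 where "L2 = nat \<lceil>8 * real n / k\<rceil>"
      have L1: "8 * real N / k \<le> real L1" "real L1 \<le> 9 * real N / k" "L1 > 0"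
      proof -
        show 1: "8 * real N / k \<le> real L1"
          unfolding L1_def by linarith
        have "real L1 \<le> 8 * real N / k + 1"
          using k unfolding L1_def by (simp add: of_nat_nat)
        also have "\<dots> \<le> 9 * real N / k"
          using k kN by (simp add: field_simps)
        finally show "real L1 \<le> 9 * real N / k" .
        have "0 < 8 * real N / k"
          using k kN by simp
        with 1 show "L1 > 0"
          by (cases L1) auto
      qed
      have L2: "8 * real n / k \<le> real L2" "real L2 \<le> 9 * real n / k" "L2 > 0"
      proof -
        show 1: "8 * real n / k \<le> real L2"
          unfolding L2_def by linarith
        have "real L2 \<le> 8 * real n / k + 1"
          using k unfolding L2_def by (simp add: of_nat_nat)
        also have "\<dots> \<le> 9 * real n / k"
          using k kn by (simp add: field_simps)
        finally show "real L2 \<le> 9 * real n / k" .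
        have "0 < 8 * real n / k"
          using k kn by simp
        with 1 show "L2 > 0"
          by (cases L2) auto
      qed
      \<comment> \<open>Ranks replace values so that a block holds at most \<open>L2\<close>
        elements of \<open>A\<close>, however unevenly \<open>A\<close> is spaced.\<close>
      define rank where "rank a = card {x\<in>A. x < a}" for a
      have rank_mono: "rank x \<le> rank y" if "x \<le> y" for x y
        unfolding rank_def using A that by (intro card_mono) auto
      have rank_less: "rank x < rank y" if "x < y" "x \<in> A" for x y
        unfolding rank_def using A that by (intro psubset_card_mono) auto
      have rank_inj: "inj_on rank A"
        by (rule inj_onI) (metis rank_less less_irrefl linorder_neqE)
      have rank_le: "rank x \<le> n" for x
        unfolding rank_def n_def using A by (intro card_mono) auto
      define g where "g c i = i div L1 + rank (c - b i) div L2" for c i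
      \<comment> \<open>The cells visited by the monotone chain of points (i, c - b i) are separated by the sum
        of their two coordinates, so there are few of them.\<close>
      have same_cell: "i div L1 = j div L1 \<and> rank (c - b i) div L2 = rank (c - b j) div L2"
        if "i \<in> J" "j \<in> J" "i < j" "g c i = g c j" for c i j
      proof -
        have "i div L1 \<le> j div L1"
          using that by (intro div_le_mono) auto
        moreover have "rank (c - b i) div L2 \<le> rank (c - b j) div L2"
          using anti[OF that(1-3)] by (intro div_le_mono rank_mono) auto
        ultimately show ?thesis
          using that(4) by (auto simp: g_def)
      qed
      define Q where "Q c = {(i, j). i \<in> S c \<and> j \<in> S c \<and> i < j \<and> g c i = g c j}" for c
      have finQ: "finite (Q c)" for c
        by (rule finite_subset[of _ "S c \<times> S c"]) (auto simp: Q_def finS)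
      have cardQ: "k / 2 \<le> real (card (Q c))" if "c \<in> T" for c
      proof -
        have "g c ` S c \<subseteq> {0..N div L1 + n div L2}"
          using J by (auto simp: g_def S_def intro!: add_mono div_le_mono rank_le)
        then have "card (g c ` S c) \<le> N div L1 + n div L2 + 1"
          using card_mono[of "{0..N div L1 + n div L2}"] by simp
        moreover have "real (N div L1) \<le> k / 8"
        proof -
          have "real (N div L1) \<le> real N / real L1"
            by (rule of_nat_div_le_of_nat)
          also have "\<dots> \<le> k / 8"
            using L1 k by (simp add: field_simps)
          finally show ?thesis .
        qed
        moreover have "real (n div L2) \<le> k / 8"
        proof -
          have "real (n div L2) \<le> real n / real L2"
            by (rule of_nat_div_le_of_nat)
          also have "\<dots> \<le> k / 8"
            using L2 k by (simp add: field_simps)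
          finally show ?thesis .
        qed
        ultimately have "real (card (g c ` S c)) \<le> k / 2"
          using k4 by linarith
        moreover have "card (S c) \<le> card (g c ` S c) + card (Q c)"
          unfolding Q_def by (rule card_le_card_image_plus_pairs[OF finS])
        moreover have "k \<le> real (card (S c))"
          using that by (simp add: T_def)
        ultimately show ?thesis
          by linarith
      qed
      \<comment> \<open>The third entry of a triple lies in the rank block of the second, which
        leaves at most \<open>L2\<close> choices for it.\<close>
      define D where "D = {1..L1} \<times> Sigma A (\<lambda>a. {a'\<in>A. rank a' div L2 = rank a div L2})"
      define \<phi> where "\<phi> = (\<lambda>(c, i, j). (j - i, c - b i, c - b j))"
      have finD: "finite D"
        unfolding D_def using A by auto
      have cardD: "card D \<le> L1 * (n * L2)"
      proof -
        have "card (Sigma A (\<lambda>a. {a'\<in>A. rank a' div L2 = rank a div L2}))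
                = (\<Sum>a\<in>A. card {a'\<in>A. rank a' div L2 = rank a div L2})"
          using A by (intro card_SigmaI) auto
        also have "\<dots> \<le> (\<Sum>a\<in>A. L2)"
          by (intro sum_mono card_div_fibre_le[OF \<open>L2 > 0\<close> rank_inj])
        also have "\<dots> = n * L2"
          by (simp add: n_def)
        finally show ?thesis
          unfolding D_def card_cartesian_product by (intro mult_mono) auto
      qed
      have "inj_on \<phi> (Sigma T Q)"
      proof (rule inj_onI)
        fix x y assume xy: "x \<in> Sigma T Q" "y \<in> Sigma T Q" "\<phi> x = \<phi> y"
        obtain c i j where x: "x = (c, i, j)"
          by (cases x) auto
        obtain c' i' j' where y: "y = (c', i', j')"
          by (cases y) auto
        have ij: "i \<in> J" "j \<in> J" "i < j" "i' \<in> J" "j' \<in> J" "i' < j'"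
          using xy by (auto simp: x y Q_def S_def)
        have eq: "j - i = j' - i'" "c - b i = c' - b i'" "c - b j = c' - b j'"
          using xy by (auto simp: x y \<phi>_def)
        \<comment> \<open>Subtracting the equations in \<open>eq\<close> gives
          \<open>b (i + h) - b i = b (i' + h) - b i'\<close>, so \<open>diff\<close> yields
          \<open>i = i'\<close>, and then \<open>c = c'\<close> follows.\<close>
        define h where "h = j - i"
        have h: "0 < h" "j = i + h" "j' = i' + h"
          using ij eq(1) by (auto simp: h_def)
        have "i = i'"
          by (rule diff[of h]) (use ij eq(2,3) h in auto)
        then show "x = y"
          using eq ij by (auto simp: x y)
      qed
      moreover have "\<phi> ` Sigma T Q \<subseteq> D"
      proof -
        have "\<phi> (c, i, j) \<in> D" if "(i, j) \<in> Q c" for c i j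
        proof -
          have ij: "i \<in> S c" "j \<in> S c" "i < j" "g c i = g c j"
            using that by (auto simp: Q_def)
          then have cell: "i div L1 = j div L1" "rank (c - b i) div L2 = rank (c - b j) div L2"
            using same_cell[of i j c] by (auto simp: S_def)
          have "j = j div L1 * L1 + j mod L1" "i = i div L1 * L1 + i mod L1" "j mod L1 < L1"
            using \<open>L1 > 0\<close> by auto
          then have "j - i \<le> L1"
            using cell(1) by (metis add_diff_cancel_left diff_le_self less_imp_le le_trans)
          then show ?thesis
            using ij cell(2) by (auto simp: \<phi>_def D_def S_def)
        qed
        then show ?thesis by auto
      qed
      ultimately have "card (Sigma T Q) \<le> card D"
        using finD by (intro card_inj_on_le)
      moreover have "card (Sigma T Q) = (\<Sum>c\<in>T. card (Q c))"
        using finT finQ by (intro card_SigmaI) auto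
      ultimately have "(\<Sum>c\<in>T. card (Q c)) \<le> L1 * (n * L2)"
        using cardD by linarith
      then have "(\<Sum>c\<in>T. real (card (Q c))) \<le> real L1 * (real n * real L2)"
        by (metis of_nat_le_iff of_nat_mult of_nat_sum)
      moreover have "real (card T) * (k / 2) \<le> (\<Sum>c\<in>T. real (card (Q c)))"
        using sum_mono[of T "\<lambda>_. k / 2"] cardQ by simp
      ultimately have "real (card T) * (k / 2) \<le> real L1 * (real n * real L2)"
        by linarith
      also have "\<dots> \<le> (9 * real N / k) * (real n * (9 * real n / k))"
        using L1 L2 k by (intro mult_mono) auto
      finally show ?thesis
        using k by (simp add: field_simps power2_eq_square power3_eq_cube)
    qed
  qed
  then show ?thesis
    by (simp add: T_def S_def n_def)
qed

text \<open>Negating \<open>b\<close>, \<open>A\<close> and \<open>c\<close> makes the sequence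
  decreasing and preserves both the counts and the hypothesis on differences.\<close>

lemma rich_translates_mono:
  fixes b :: "nat \<Rightarrow> real"
  assumes J: "J \<subseteq> {1..N}"
    and mono: "\<And>i j. i \<in> J \<Longrightarrow> j \<in> J \<Longrightarrow> i < j \<Longrightarrow> b i < b j"
    and diff: "\<And>i j h. 0 < h \<Longrightarrow> i \<in> J \<Longrightarrow> i + h \<in> J \<Longrightarrow> j \<in> J \<Longrightarrow> j + h \<in> J \<Longrightarrow>
                 b (i + h) - b i = b (j + h) - b j \<Longrightarrow> i = j"
    and A: "finite A" and k: "k > 0"
  shows "real (card {c. k \<le> real (card {i\<in>J. c - b i \<in> A})}) * k ^ 3
           \<le> 162 * real N * real (card A) ^ 2"
proof -
  have "real (card {c. k \<le> real (card {i\<in>J. c - (- b i) \<in> uminus ` A})}) * k ^ 3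
           \<le> 162 * real N * real (card (uminus ` A)) ^ 2"
  proof (rule rich_translates_antimono[OF J _ _ _ k])
    show "i = j" if "0 < h" "i \<in> J" "i + h \<in> J" "j \<in> J" "j + h \<in> J"
      "- b (i + h) - (- b i) = - b (j + h) - (- b j)" for i j h
      using diff[of h i j] that by simp
  qed (use mono A in auto)
  moreover have "{c. k \<le> real (card {i\<in>J. c - (- b i) \<in> uminus ` A})}
      = uminus ` {c. k \<le> real (card {i\<in>J. c - b i \<in> A})}"
  proof -
    have *: "c - (- b i) \<in> uminus ` A \<longleftrightarrow> - c - b i \<in> A" for c i
    proof -
      have "uminus ` A = {x. - x \<in> A}"
        by force
      then show ?thesis by simp
    qed
    show ?thesis
      unfolding * by (auto simp: image_iff) (metis minus_minus)
  qed
  ultimately show ?thesis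
    by (simp add: card_image)
qed

text \<open>The points \<open>j\<close> and \<open>i + h\<close> are convex combinations of the
  endpoints \<open>i\<close> and \<open>j + h\<close> with interchanged weights; adding the two
  convexity inequalities gives the claim.\<close>

lemma strictly_convex_seq_diff:
  assumes "strictly_convex_seq N b" "1 \<le> i" "i < j" "j + h \<le> N" "0 < h"
  shows "b (i + h) - b i < b (j + h) - b j"
proof -
  obtain f where f: "strictly_convex_on UNIV f" "\<And>i. i \<in> {1..N} \<Longrightarrow> f (real i) = b i"
    using assms(1) by (auto simp: strictly_convex_seq_def)
  define D where "D = real j - real i + real h"
  define u where "u = real h / D"
  define v where "v = (real j - real i) / D"
  have D: "D > 0"
    using assms by (simp add: D_def)
  have uv: "u > 0" "v > 0"
    using assms D by (auto simp: u_def v_def)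
  have uv1: "u + v = 1"
    using D by (simp add: u_def v_def flip: add_divide_distrib) (simp add: D_def)
  have ne: "real i \<noteq> real (j + h)"
    using assms by linarith
  have vD: "v * D = real j - real i"
    using D by (simp add: v_def)
  have u1: "u = 1 - v"
    using uv1 by simp
  have e: "real (j + h) = real i + D"
    by (simp add: D_def)
  have e1: "u * real i + v * real (j + h) = real j"
    unfolding e u1 using vD by (simp add: algebra_simps)
  have e2: "v * real i + u * real (j + h) = real (i + h)"
    unfolding e u1 using vD by (simp add: algebra_simps D_def)
  have "f (real j) < u * f (real i) + v * f (real (j + h))"
    using f(1) uv uv1 ne e1 unfolding strictly_convex_on_def
    by (metis UNIV_I real_scaleR_def)
  moreover have "f (real (i + h)) < v * f (real i) + u * f (real (j + h))"
    using f(1) uv uv1 ne e2 unfolding strictly_convex_on_def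
    by (metis UNIV_I real_scaleR_def add.commute)
  moreover have "f (real j) = b j" "f (real i) = b i" "f (real (i + h)) = b (i + h)"
      "f (real (j + h)) = b (j + h)"
    using assms by (intro f(2); simp)+
  ultimately have "b j + b (i + h) < (u + v) * b i + (u + v) * b (j + h)"
    by (simp add: algebra_simps)
  then show ?thesis
    using uv1 by simp
qed

text \<open>A weighted mean of the end values is at most their maximum. This is what splits the
  sequence into two monotone pieces without locating a minimum.\<close>

lemma strictly_convex_seq_less_max:
  assumes "strictly_convex_seq N b" "1 \<le> i" "i < j" "j < k" "k \<le> N"
  shows "b j < max (b i) (b k)"
proof -
  obtain f where f: "strictly_convex_on UNIV f" "\<And>i. i \<in> {1..N} \<Longrightarrow> f (real i) = b i"
    using assms(1) by (auto simp: strictly_convex_seq_def)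
  define v where "v = (real j - real i) / (real k - real i)"
  have uv: "1 - v > 0" "v > 0"
    using assms by (auto simp: v_def field_simps)
  have "v * (real k - real i) = real j - real i"
    using assms by (simp add: v_def)
  then have e: "(1 - v) * real i + v * real k = real j"
    by (simp add: algebra_simps)
  have "f (real j) < (1 - v) * f (real i) + v * f (real k)"
    using f(1) uv e assms unfolding strictly_convex_on_def
    by (metis UNIV_I real_scaleR_def diff_add_cancel less_trans nat_neq_iff of_nat_eq_iff)
  also have "\<dots> = (1 - v) * b i + v * b k"
    using f(2) assms by auto
  also have "\<dots> \<le> (1 - v) * max (b i) (b k) + v * max (b i) (b k)"
    using uv by (intro add_mono mult_left_mono) auto
  also have "\<dots> = max (b i) (b k)"
    by (simp add: algebra_simps)
  finally show ?thesis
    using f(2)[of j] assms by auto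
qed

text \<open>A translate rich at \<open>k\<close> is rich at \<open>k / 2\<close> on one of two
  monotone pieces, so the constant is \<open>2 * 8 * 162\<close>. Finiteness is a separate
  conclusion because \<open>card\<close> is 0 on infinite sets.\<close>

lemma rich_translates:
  assumes b: "strictly_convex_seq N b" and A: "finite A" and k: "k > 0"
  shows "real (card {c. k \<le> real (card {i\<in>{1..N}. c - b i \<in> A})}) * k ^ 3
           \<le> 2592 * real N * real (card A) ^ 2"
    and "finite {c. k \<le> real (card {i\<in>{1..N}. c - b i \<in> A})}"
proof -
  \<comment> \<open>\<open>J1\<close> collects the strict record minima seen from the left,
    \<open>J2\<close> those seen from the right; \<open>b\<close> decreases along \<open>J1\<close>
    and increases along \<open>J2\<close>.\<close>
  define J1 where "J1 = {i\<in>{1..N}. \<forall>j. 1 \<le> j \<and> j < i \<longrightarrow> b i < b j}"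
  define J2 where "J2 = {i\<in>{1..N}. \<forall>j. i < j \<and> j \<le> N \<longrightarrow> b i < b j}"
  define R where "R J k = {c. k \<le> real (card {i\<in>J. c - b i \<in> A})}" for J k
  have fin: "finite (R J k)" if "J \<subseteq> {1..N}" "k > 0" for J k
  proof (rule finite_subset)
    show "R J k \<subseteq> (\<lambda>(a, i). a + b i) ` (A \<times> {1..N})"
    proof
      fix c assume "c \<in> R J k"
      then have "{i\<in>J. c - b i \<in> A} \<noteq> {}"
        using \<open>k > 0\<close> unfolding R_def by (metis (mono_tags) card.empty mem_Collect_eq of_nat_0 not_le)
      then obtain i where "i \<in> J" "c - b i \<in> A"
        by auto
      then show "c \<in> (\<lambda>(a, i). a + b i) ` (A \<times> {1..N})"
        using that by (intro image_eqI[of _ _ "(c - b i, i)"]) auto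
    qed
  qed (use A in auto)
  have un: "{1..N} = J1 \<union> J2"
  proof -
    \<comment> \<open>An index outside both pieces would have a value at least as large as one on
      its left and one on its right, contrary to strict convexity.\<close>
    have "b i < b j" if "1 \<le> j" "j < i" "i < j'" "j' \<le> N" "\<not> b i < b j'" for i j j'
      using strictly_convex_seq_less_max[OF b that(1-4)] that(5) by auto
    then show ?thesis
      by (auto simp: J1_def J2_def)
  qed
  have diff: "i = j" if "0 < h" "i \<in> {1..N}" "i + h \<in> {1..N}" "j \<in> {1..N}" "j + h \<in> {1..N}"
      "b (i + h) - b i = b (j + h) - b j" for i j h
    using strictly_convex_seq_diff[OF b, of i j h] strictly_convex_seq_diff[OF b, of j i h] that
    by (cases i j rule: linorder_cases) auto
  have sub: "J1 \<subseteq> {1..N}" "J2 \<subseteq> {1..N}"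
    by (auto simp: J1_def J2_def)
  have k2: "k / 2 > 0"
    using k by simp
  have 1: "real (card (R J1 (k/2))) * (k/2) ^ 3 \<le> 162 * real N * real (card A) ^ 2"
    unfolding R_def
    by (rule rich_translates_antimono[OF sub(1) _ diff A k2]) (use sub in \<open>auto simp: J1_def\<close>)
  have 2: "real (card (R J2 (k/2))) * (k/2) ^ 3 \<le> 162 * real N * real (card A) ^ 2"
    unfolding R_def
    by (rule rich_translates_mono[OF sub(2) _ diff A k2]) (use sub in \<open>auto simp: J2_def\<close>)
  have "R {1..N} k \<subseteq> R J1 (k/2) \<union> R J2 (k/2)"
  proof
    fix c assume "c \<in> R {1..N} k"
    moreover have "{i\<in>{1..N}. c - b i \<in> A} = {i\<in>J1. c - b i \<in> A} \<union> {i\<in>J2. c - b i \<in> A}"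
      unfolding un by auto
    then have "card {i\<in>{1..N}. c - b i \<in> A} \<le> card {i\<in>J1. c - b i \<in> A} + card {i\<in>J2. c - b i \<in> A}"
      by (simp only: card_Un_le)
    ultimately show "c \<in> R J1 (k/2) \<union> R J2 (k/2)"
      by (auto simp: R_def)
  qed
  then have "card (R {1..N} k) \<le> card (R J1 (k/2) \<union> R J2 (k/2))"
    using fin sub k2 by (intro card_mono) auto
  also have "\<dots> \<le> card (R J1 (k/2)) + card (R J2 (k/2))"
    by (rule card_Un_le)
  finally have "real (card (R {1..N} k)) * k ^ 3
      \<le> (real (card (R J1 (k/2))) + real (card (R J2 (k/2)))) * k ^ 3"
    using k by (intro mult_right_mono) auto
  also have "\<dots> = 8 * (real (card (R J1 (k/2))) * (k/2) ^ 3) + 8 * (real (card (R J2 (k/2))) * (k/2) ^ 3)"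
    by (simp add: field_simps)
  also have "\<dots> \<le> 2592 * real N * real (card A) ^ 2"
    using 1 2 by linarith
  finally show "real (card {c. k \<le> real (card {i\<in>{1..N}. c - b i \<in> A})}) * k ^ 3
           \<le> 2592 * real N * real (card A) ^ 2"
    by (simp add: R_def)
  show "finite {c. k \<le> real (card {i\<in>{1..N}. c - b i \<in> A})}"
    using fin[of "{1..N}" k] k by (simp add: R_def)
qed

subsection \<open>Dyadic decomposition\<close>

lemma sum_power_inj_le:
  fixes x :: real
  assumes "finite A" "inj_on g A" "0 \<le> x" "x < 1"
  shows "(\<Sum>s\<in>A. x ^ g s) \<le> 1 / (1 - x)"
proof -
  have "(\<Sum>s\<in>A. x ^ g s) = (\<Sum>j\<in>g ` A. x ^ j)"
    by (simp add: sum.reindex[OF assms(2)])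
  also have "\<dots> \<le> (\<Sum>j. x ^ j)"
    using assms by (intro sum_le_suminf summable_geometric) auto
  also have "\<dots> = 1 / (1 - x)"
    using assms by (intro suminf_geometric) auto
  finally show ?thesis .
qed

text \<open>One of the two truncated differences is always 0, so this is the distance of
  \<open>m\<close> and \<open>s\<close>.\<close>

definition ndist :: "nat \<Rightarrow> nat \<Rightarrow> nat" where
  "ndist m s = (s - m) + (m - s)"

lemma sum_power_ndist_le:
  fixes x :: real
  assumes "0 \<le> x" "x < 1"
  shows "(\<Sum>s<S. x ^ ndist m s) \<le> 2 / (1 - x)"
proof -
  have "(\<Sum>s<S. x ^ ndist m s)
      = (\<Sum>s\<in>{..<S} \<inter> {..m}. x ^ ndist m s) + (\<Sum>s\<in>{..<S} - {..m}. x ^ ndist m s)"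
    by (rule sum.Int_Diff) simp
  also have "\<dots> \<le> 1 / (1 - x) + 1 / (1 - x)"
    using assms by (intro add_mono sum_power_inj_le) (auto simp: inj_on_def ndist_def)
  finally show ?thesis
    by simp
qed

text \<open>Weights are natural numbers, so every positive value lies in exactly one level and 0
  lies in none.\<close>

definition level :: "('a \<Rightarrow> nat) \<Rightarrow> nat \<Rightarrow> 'a set" where
  "level w s = {a. 2 ^ s \<le> w a \<and> w a < 2 ^ (s + 1)}"

lemma level_pos: "a \<in> level w s \<Longrightarrow> w a > 0"
  by (rule ccontr) (simp add: level_def)

text \<open>A positive value is below the upper end of its level, so one summand already suffices;
  the cutoff \<open>S\<close> keeps the sum finite.\<close>

lemma power_le_sum_levels:
  assumes "w a < 2 ^ S" "p > 0"
  shows "real (w a) ^ p \<le> (\<Sum>s<S. (2 ^ (s + 1)) ^ p * of_bool (a \<in> level w s))"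
proof (cases "w a = 0")
  case True
  then show ?thesis
    using assms by (auto simp: zero_power intro!: sum_nonneg)
next
  case False
  then obtain s where s: "2 ^ s \<le> w a" "w a < 2 ^ (s + 1)"
    using ex_power_ivl1[of 2 "w a"] by auto
  then have "(2::nat) ^ s < 2 ^ S"
    using assms by linarith
  then have "s < S"
    by simp
  have "real (w a) < 2 ^ (s + 1)"
    using s(2) by (metis of_nat_less_iff of_nat_numeral of_nat_power)
  then have "real (w a) ^ p \<le> (2 ^ (s + 1)) ^ p"
    by (intro power_mono) auto
  also have "\<dots> = (2 ^ (s + 1)) ^ p * of_bool (a \<in> level w s)"
    using s by (simp add: level_def)
  also have "\<dots> \<le> (\<Sum>s<S. (2 ^ (s + 1)) ^ p * of_bool (a \<in> level w s))"
    using \<open>s < S\<close> by (intro member_le_sum) auto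
  finally show ?thesis .
qed

text \<open>\<open>M\<close> bounds the mass of \<open>w\<close>, and \<open>P\<close> the cube of
  its weak \<open>L^3\<close> quasinorm. \<open>W\<close> is the height at which the mass bound
  gives way to the weak bound, and \<open>m\<close> is its dyadic exponent.\<close>

context
  fixes w :: "real \<Rightarrow> nat" and M P W :: real and S m :: nat
  assumes fin: "finite {a. w a > 0}"
    and mass: "(\<Sum>a | w a > 0. real (w a)) \<le> M"
    and weak: "\<And>n. n \<ge> 1 \<Longrightarrow> real (card {a. n \<le> w a}) * real n ^ 3 \<le> P"
    and W: "2 ^ m \<le> W" "W < 2 ^ (m + 1)"
    and S: "\<And>a. w a < 2 ^ S"
begin

lemma finite_level: "finite (level w s)"
  by (rule finite_subset[OF _ fin]) (auto intro: level_pos)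

lemma mass_nonneg: "M \<ge> 0"
  by (rule order_trans[OF _ mass]) (auto intro: sum_nonneg)

lemma weak_nonneg: "P \<ge> 0"
  by (rule order_trans[OF _ weak[of 1]]) auto

lemma card_level_mass: "real (card (level w s)) * 2 ^ s \<le> M"
proof -
  have "real (card (level w s)) * 2 ^ s = (\<Sum>a\<in>level w s. 2 ^ s)"
    by simp
  also have "\<dots> \<le> (\<Sum>a\<in>level w s. real (w a))"
    by (intro sum_mono) (auto simp: level_def)
  also have "\<dots> \<le> (\<Sum>a | w a > 0. real (w a))"
    using fin by (intro sum_mono2) (auto intro: level_pos)
  finally show ?thesis
    using mass by linarith
qed

lemma card_level_weak: "real (card (level w s)) * 8 ^ s \<le> P"
proof -
  have "finite {a. 2 ^ s \<le> w a}"
    by (intro finite_subset[OF _ fin] subsetI) (rule ccontr, simp)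
  then have "card (level w s) \<le> card {a. 2 ^ s \<le> w a}"
    by (intro card_mono) (auto simp: level_def)
  then have "real (card (level w s)) * 8 ^ s \<le> real (card {a. 2 ^ s \<le> w a}) * 8 ^ s"
    by simp
  also have "\<dots> = real (card {a. 2 ^ s \<le> w a}) * real (2 ^ s) ^ 3"
    by (simp add: power3_eq_cube flip: power_mult_distrib)
  also have "\<dots> \<le> P"
    by (rule weak) simp
  finally show ?thesis .
qed

text \<open>Up to \<open>m\<close> the mass bound grows like \<open>2 ^ s\<close>; beyond
  \<open>m\<close> the weak bound decays at the inverse rate. Hence the geometric falloff on both
  sides of \<open>m\<close>.\<close>

lemma card_level_square:
  "real (card (level w s)) * 4 ^ s \<le> (1 / 2) ^ ndist m s * (M * W + 2 * P / W)"
proof (cases "s \<le> m")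
  case True
  have "real (card (level w s)) * 4 ^ s = real (card (level w s)) * 2 ^ s * 2 ^ s"
    by (simp flip: power_mult_distrib)
  also have "\<dots> \<le> M * 2 ^ s"
    by (intro mult_right_mono card_level_mass) auto
  also have "\<dots> = M * ((1 / 2) ^ ndist m s * 2 ^ m)"
    using True by (simp add: ndist_def power_diff field_simps)
  also have "\<dots> \<le> M * ((1 / 2) ^ ndist m s * W)"
    using W mass_nonneg by (intro mult_left_mono) auto
  also have "\<dots> = (1 / 2) ^ ndist m s * (M * W)"
    by simp
  also have "\<dots> \<le> (1 / 2) ^ ndist m s * (M * W + 2 * P / W)"
    using W weak_nonneg less_le_trans[OF _ W(1), of 0] by (intro mult_left_mono) auto
  finally show ?thesis .
next
  case False
  have W0: "W > 0"
    using less_le_trans[OF _ W(1), of 0] by simp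
  have "real (card (level w s)) * 4 ^ s = real (card (level w s)) * 8 ^ s * (1 / 2) ^ s"
    by (simp flip: power_mult_distrib)
  also have "\<dots> \<le> P * (1 / 2) ^ s"
    by (intro mult_right_mono card_level_weak) auto
  also have "\<dots> = (1 / 2) ^ ndist m s * (P * (1 / 2 ^ m))"
    using False by (simp add: ndist_def power_diff field_simps)
  also have "\<dots> \<le> (1 / 2) ^ ndist m s * (P * (2 / W))"
    using W W0 weak_nonneg by (intro mult_left_mono) (auto simp: field_simps)
  also have "\<dots> \<le> (1 / 2) ^ ndist m s * (M * W + 2 * P / W)"
    using W0 mass_nonneg by (intro mult_left_mono) (auto simp: mult.commute)
  finally show ?thesis .
qed

text \<open>The left side is what \<open>rich_translates\<close> yields for a level at a threshold
  proportional to \<open>1 / 2 ^ s\<close>. Beyond \<open>m\<close> the decay has ratio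
  \<open>1 / 8\<close>, weakened to \<open>1 / 2\<close> to match the other side.\<close>

lemma card_level_cube:
  "real (card (level w s)) ^ 2 * 8 ^ s \<le> (1 / 2) ^ ndist m s * (M ^ 2 * W + 8 * P ^ 2 / W ^ 3)"
proof (cases "s \<le> m")
  case True
  have "real (card (level w s)) ^ 2 * 8 ^ s = (real (card (level w s)) * 2 ^ s) ^ 2 * 2 ^ s"
    by (simp add: power2_eq_square flip: power_mult_distrib)
  also have "\<dots> \<le> M ^ 2 * 2 ^ s"
    by (intro mult_right_mono power_mono card_level_mass) auto
  also have "\<dots> = M ^ 2 * ((1 / 2) ^ ndist m s * 2 ^ m)"
    using True by (simp add: ndist_def power_diff field_simps)
  also have "\<dots> \<le> M ^ 2 * ((1 / 2) ^ ndist m s * W)"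
    using W mass_nonneg by (intro mult_left_mono) auto
  also have "\<dots> = (1 / 2) ^ ndist m s * (M ^ 2 * W)"
    by simp
  also have "\<dots> \<le> (1 / 2) ^ ndist m s * (M ^ 2 * W + 8 * P ^ 2 / W ^ 3)"
    using W weak_nonneg less_le_trans[OF _ W(1), of 0] by (intro mult_left_mono) auto
  finally show ?thesis .
next
  case False
  have W0: "W > 0"
    using less_le_trans[OF _ W(1), of 0] by simp
  have "real (card (level w s)) ^ 2 * 8 ^ s = (real (card (level w s)) * 8 ^ s) ^ 2 * (1 / 8) ^ s"
    by (simp add: power2_eq_square flip: power_mult_distrib)
  also have "\<dots> \<le> P ^ 2 * (1 / 8) ^ s"
    by (intro mult_right_mono power_mono card_level_weak) auto
  also have "(1 / 8) ^ s = (1 / 8 :: real) ^ ndist m s * (1 / 2 ^ m) ^ 3"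
  proof -
    have "(1 / 2 ^ m :: real) ^ 3 = (1 / 8) ^ m"
      by (simp add: power3_eq_cube power_divide flip: power_mult_distrib)
    then show ?thesis
      using False by (simp add: ndist_def flip: power_add)
  qed
  also have "P ^ 2 * ((1 / 8) ^ ndist m s * (1 / 2 ^ m) ^ 3)
      \<le> P ^ 2 * ((1 / 2) ^ ndist m s * (2 / W) ^ 3)"
    using W W0 by (intro mult_left_mono mult_mono power_mono) (auto simp: field_simps)
  also have "\<dots> = (1 / 2) ^ ndist m s * (8 * P ^ 2 / W ^ 3)"
    by (simp add: power_divide)
  also have "\<dots> \<le> (1 / 2) ^ ndist m s * (M ^ 2 * W + 8 * P ^ 2 / W ^ 3)"
    using W0 mass_nonneg by (intro mult_left_mono) auto
  finally show ?thesis .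
qed

text \<open>In \<open>16 = 4 * 4\<close> one factor comes from squaring the upper end
  \<open>2 ^ (s + 1)\<close>, the other from the two-sided geometric series.\<close>

lemma second_moment_le_aux: "(\<Sum>a | w a > 0. real (w a) ^ 2) \<le> 16 * (M * W + 2 * P / W)"
proof -
  have "(\<Sum>a | w a > 0. real (w a) ^ 2)
      \<le> (\<Sum>a | w a > 0. \<Sum>s<S. (2 ^ (s + 1)) ^ 2 * of_bool (a \<in> level w s))"
    by (intro sum_mono power_le_sum_levels S) auto
  also have "\<dots> = (\<Sum>s<S. \<Sum>a | w a > 0. (2 ^ (s + 1)) ^ 2 * of_bool (a \<in> level w s))"
    by (rule sum.swap)
  also have "\<dots> = (\<Sum>s<S. 4 * (real (card (level w s)) * 4 ^ s))"
  proof (rule sum.cong)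
    fix s
    have "{a. w a > 0} \<inter> level w s = level w s"
      by (auto intro: level_pos)
    then have "(\<Sum>a | w a > 0. of_bool (a \<in> level w s)) = real (card (level w s))"
      using fin by (simp add: of_bool_def sum.If_cases)
    moreover have "((2::real) ^ (s + 1)) ^ 2 = 4 * 4 ^ s"
      by (simp add: power2_eq_square flip: power_mult_distrib)
    ultimately show "(\<Sum>a | w a > 0. (2 ^ (s + 1)) ^ 2 * of_bool (a \<in> level w s))
        = 4 * (real (card (level w s)) * 4 ^ s)"
      by (simp flip: sum_distrib_left)
  qed simp
  also have "\<dots> \<le> (\<Sum>s<S. 4 * ((1 / 2) ^ ndist m s * (M * W + 2 * P / W)))"
    by (intro sum_mono mult_left_mono card_level_square) auto
  also have "\<dots> = 4 * (M * W + 2 * P / W) * (\<Sum>s<S. (1 / 2) ^ ndist m s)"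
    unfolding sum_distrib_left by (simp only: mult_ac)
  also have "\<dots> \<le> 4 * (M * W + 2 * P / W) * 4"
    using sum_power_ndist_le[of "1 / 2" m S] mass_nonneg weak_nonneg less_le_trans[OF _ W(1), of 0]
    by (intro mult_left_mono) auto
  finally show ?thesis
    by simp
qed

text \<open>If the convolution reaches \<open>\<tau>\<close> at \<open>c\<close>, some level
  supplies at least its share \<open>\<epsilon> s\<close> of \<open>\<tau>\<close>, so
  \<open>c\<close> is a rich translate of that level. Summing \<open>rich_translates\<close> over
  the levels gives the bound.\<close>

lemma weak_convolution_le_aux:
  assumes b: "strictly_convex_seq N b" and \<tau>: "\<tau> > 0"
  shows "real (card {c. \<tau> \<le> real (\<Sum>i=1..N. w (c - b i))}) * \<tau> ^ 3
           \<le> 1327104000 * real N * (M ^ 2 * W + 8 * P ^ 2 / W ^ 3)"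
proof -
  define Q where "Q = M ^ 2 * W + 8 * P ^ 2 / W ^ 3"
  define r where "r s c = card {i\<in>{1..N}. c - b i \<in> level w s}" for s c
  \<comment> \<open>Shares of the threshold with total at most 1, decaying slowly enough (ratio 9/10, whose
    cube exceeds 1/2) for the levelwise estimates still to be summable.\<close>
  define \<epsilon> where "\<epsilon> s = (9 / 10) ^ ndist m s / (20::real)" for s
  define T where "T s = {c. \<tau> * \<epsilon> s / 2 ^ (s + 1) \<le> real (r s c)}" for s
  have Q: "Q \<ge> 0"
    using mass_nonneg weak_nonneg less_le_trans[OF _ W(1), of 0] by (simp add: Q_def)
  have \<epsilon>: "\<epsilon> s > 0" for s
    by (simp add: \<epsilon>_def)
  have kpos: "\<tau> * \<epsilon> s / 2 ^ (s + 1) > 0" for s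
    using \<tau> \<epsilon> by simp
  have "{c. \<tau> \<le> real (\<Sum>i=1..N. w (c - b i))} \<subseteq> (\<Union>s<S. T s)"
  proof (rule subsetI, rule ccontr)
    fix c assume c: "c \<in> {c. \<tau> \<le> real (\<Sum>i=1..N. w (c - b i))}" "c \<notin> (\<Union>s<S. T s)"
    have "real (\<Sum>i=1..N. w (c - b i)) = (\<Sum>i=1..N. real (w (c - b i)) ^ 1)"
      by simp
    also have "\<dots> \<le> (\<Sum>i=1..N. \<Sum>s<S. (2 ^ (s + 1)) ^ 1 * of_bool (c - b i \<in> level w s))"
      by (intro sum_mono power_le_sum_levels S) auto
    also have "\<dots> = (\<Sum>s<S. \<Sum>i=1..N. (2 ^ (s + 1)) ^ 1 * of_bool (c - b i \<in> level w s))"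
      by (rule sum.swap)
    also have "\<dots> = (\<Sum>s<S. 2 ^ (s + 1) * real (r s c))"
    proof (rule sum.cong)
      fix s
      have "(\<Sum>i=1..N. of_bool (c - b i \<in> level w s)) = real (r s c)"
        by (simp add: of_bool_def sum.If_cases r_def Int_def conj_commute)
      then show "(\<Sum>i=1..N. (2 ^ (s + 1)) ^ 1 * of_bool (c - b i \<in> level w s))
          = 2 ^ (s + 1) * real (r s c)"
        by (simp flip: sum_distrib_left)
    qed simp
    finally have le: "\<tau> \<le> (\<Sum>s<S. 2 ^ (s + 1) * real (r s c))"
      using c(1) by simp
    have "S \<noteq> 0"
      using le \<tau> by (cases S) auto
    then have "(\<Sum>s<S. 2 ^ (s + 1) * real (r s c)) < (\<Sum>s<S. \<tau> * \<epsilon> s)"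
      using c(2) by (intro sum_strict_mono) (auto simp: T_def field_simps not_le)
    also have "\<dots> = \<tau> / 20 * (\<Sum>s<S. (9 / 10) ^ ndist m s)"
      by (simp add: \<epsilon>_def sum_distrib_left)
    also have "\<dots> \<le> \<tau> / 20 * 20"
      using sum_power_ndist_le[of "9 / 10" m S] \<tau> by (intro mult_left_mono) auto
    finally show False
      using le by simp
  qed
  moreover have finT: "finite (T s)" for s
    unfolding T_def r_def by (rule rich_translates(2)[OF b finite_level kpos])
  ultimately have "card {c. \<tau> \<le> real (\<Sum>i=1..N. w (c - b i))} \<le> card (\<Union>s<S. T s)"
    by (intro card_mono) auto
  also have "\<dots> \<le> (\<Sum>s<S. card (T s))"
    by (rule card_UN_le) simp
  finally have "real (card {c. \<tau> \<le> real (\<Sum>i=1..N. w (c - b i))}) * \<tau> ^ 3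
      \<le> (\<Sum>s<S. real (card (T s))) * \<tau> ^ 3"
    using \<tau> by (intro mult_right_mono) (auto simp flip: of_nat_sum)
  also have "\<dots> = (\<Sum>s<S. real (card (T s)) * \<tau> ^ 3)"
    by (rule sum_distrib_right)
  also have "\<dots> \<le> (\<Sum>s<S. 165888000 * real N * Q * (500 / 729) ^ ndist m s)"
  proof (rule sum_mono)
    fix s
    \<comment> \<open>Here \<open>64000 = 20 ^ 3 * 2 ^ 3\<close>, from the normalisation of
      \<open>\<epsilon>\<close> and the upper end of the level; times 2592 it is 165888000.\<close>
    have e3: "(\<tau> * \<epsilon> s / 2 ^ (s + 1)) ^ 3 = \<tau> ^ 3 * (729 / 1000) ^ ndist m s / (64000 * 8 ^ s)"
    proof -
      have "((9 / 10 :: real) ^ ndist m s) ^ 3 = (729 / 1000) ^ ndist m s"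
        by (simp add: power3_eq_cube flip: power_mult_distrib)
      moreover have "((2::real) ^ s) ^ 3 = 8 ^ s"
        by (simp add: power3_eq_cube flip: power_mult_distrib)
      moreover have "(\<tau> * (x / 20) / 2 ^ (s + 1)) ^ 3 = \<tau> ^ 3 * x ^ 3 / (64000 * (2 ^ s) ^ 3)" for x
        by (simp add: power_mult_distrib power_divide)
      ultimately show ?thesis
        by (simp only: \<epsilon>_def)
    qed
    have "real (card (T s)) * (\<tau> * \<epsilon> s / 2 ^ (s + 1)) ^ 3
        \<le> 2592 * real N * real (card (level w s)) ^ 2"
      unfolding T_def r_def by (rule rich_translates(1)[OF b finite_level kpos])
    then have "real (card (T s)) * \<tau> ^ 3 * (729 / 1000) ^ ndist m s
        \<le> 165888000 * real N * (real (card (level w s)) ^ 2 * 8 ^ s)"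
      unfolding e3 by (simp add: field_simps)
    also have "\<dots> \<le> 165888000 * real N * ((1 / 2) ^ ndist m s * Q)"
      unfolding Q_def by (intro mult_left_mono card_level_cube) auto
    \<comment> \<open>The cubed share costs \<open>729 / 1000\<close> per level; dividing it out of
      the decay \<open>1 / 2\<close> leaves the ratio \<open>500 / 729 < 1\<close>.\<close>
    also have "(1 / 2 :: real) ^ ndist m s = (500 / 729) ^ ndist m s * (729 / 1000) ^ ndist m s"
      by (simp flip: power_mult_distrib)
    finally have "real (card (T s)) * \<tau> ^ 3 * (729 / 1000) ^ ndist m s
        \<le> 165888000 * real N * Q * (500 / 729) ^ ndist m s * (729 / 1000) ^ ndist m s"
      by (simp only: mult_ac)
    then show "real (card (T s)) * \<tau> ^ 3 \<le> 165888000 * real N * Q * (500 / 729) ^ ndist m s"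
      by (rule mult_right_le_imp_le) simp
  qed
  also have "\<dots> = 165888000 * real N * Q * (\<Sum>s<S. (500 / 729) ^ ndist m s)"
    by (simp add: sum_distrib_left)
  also have "\<dots> \<le> 165888000 * real N * Q * 8"
  proof (rule mult_left_mono)
    show "(\<Sum>s<S. (500 / 729 :: real) ^ ndist m s) \<le> 8"
      using sum_power_ndist_le[of "500 / 729" m S] by simp
  qed (use Q in auto)
  finally show ?thesis
    by (simp add: Q_def)
qed

end

text \<open>The auxiliary \<open>m\<close> and \<open>S\<close> are chosen here, \<open>m\<close>
  from the integer part of \<open>W\<close> and \<open>S\<close> from the largest weight, so that
  only \<open>W\<close> remains as a parameter.\<close>

lemma
  fixes w :: "real \<Rightarrow> nat" and M P W :: real
  assumes fin: "finite {a. w a > 0}"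
    and mass: "(\<Sum>a | w a > 0. real (w a)) \<le> M"
    and weak: "\<And>n. n \<ge> 1 \<Longrightarrow> real (card {a. n \<le> w a}) * real n ^ 3 \<le> P"
    and W: "1 \<le> W"
  shows second_moment_le: "(\<Sum>a | w a > 0. real (w a) ^ 2) \<le> 16 * (M * W + 2 * P / W)"
    and weak_convolution_le: "strictly_convex_seq N b \<Longrightarrow> \<tau> > 0 \<Longrightarrow>
         real (card {c. \<tau> \<le> real (\<Sum>i=1..N. w (c - b i))}) * \<tau> ^ 3
           \<le> 1327104000 * real N * (M ^ 2 * W + 8 * P ^ 2 / W ^ 3)"
proof -
  obtain m where "2 ^ m \<le> nat \<lfloor>W\<rfloor>" "nat \<lfloor>W\<rfloor> < 2 ^ (m + 1)"
    using ex_power_ivl1[of 2 "nat \<lfloor>W\<rfloor>"] W by (metis le_nat_floor of_nat_1 order_refl)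
  then have "(2::int) ^ m \<le> \<lfloor>W\<rfloor>" "\<lfloor>W\<rfloor> < (2::int) ^ (m + 1)"
    using W by (auto simp: nat_less_iff le_nat_iff)
  then have m: "2 ^ m \<le> W" "W < 2 ^ (m + 1)"
    by (auto simp: le_floor_iff floor_less_iff)
  obtain S where S: "w a < 2 ^ S" for a
  proof
    fix a
    show "w a < 2 ^ Max (insert 0 (w ` {a. w a > 0}))"
    proof (cases "w a > 0")
      case True
      then have "w a \<le> Max (insert 0 (w ` {a. w a > 0}))"
        using fin by (intro Max_ge) auto
      then show ?thesis
        using less_exp[of "Max (insert 0 (w ` {a. w a > 0}))"] by linarith
    qed simp
  qed
  show "(\<Sum>a | w a > 0. real (w a) ^ 2) \<le> 16 * (M * W + 2 * P / W)"
    by (rule second_moment_le_aux[OF fin mass weak m S])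
  show "real (card {c. \<tau> \<le> real (\<Sum>i=1..N. w (c - b i))}) * \<tau> ^ 3
           \<le> 1327104000 * real N * (M ^ 2 * W + 8 * P ^ 2 / W ^ 3)"
    if "strictly_convex_seq N b" "\<tau> > 0"
    by (rule weak_convolution_le_aux[OF fin mass weak m S that])
qed

subsection \<open>Representation functions of iterated sums\<close>

text \<open>This is \<nu> without the factor \<open>1 / fact d\<close>; its natural values suit the
  dyadic levels.\<close>

definition rep :: "nat \<Rightarrow> nat \<Rightarrow> (nat \<Rightarrow> real) \<Rightarrow> real \<Rightarrow> nat" where
  "rep d N b c = card {i \<in> tuples d N. (\<Sum>k=1..d. b (i k)) = c}"

lemma finite_tuples: "finite (tuples d N)"
  unfolding tuples_def by (intro finite_PiE) auto

lemma card_tuples: "card (tuples d N) = N ^ d"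
  by (simp add: tuples_def card_PiE)

lemma sumset_eq: "sumset d N b = (\<lambda>i. \<Sum>k=1..d. b (i k)) ` tuples d N"
  by (auto simp: sumset_def)

lemma finite_sumset: "finite (sumset d N b)"
  by (simp add: sumset_eq finite_tuples)

lemma rep_pos_iff: "rep d N b c > 0 \<longleftrightarrow> c \<in> sumset d N b"
  by (auto simp: rep_def card_gt_0_iff finite_tuples sumset_eq)

lemma Collect_rep_pos: "{c. rep d N b c > 0} = sumset d N b"
  by (simp add: rep_pos_iff)

lemma sum_rep: "(\<Sum>c\<in>sumset d N b. rep d N b c) = N ^ d"
proof -
  have "card (tuples d N) = (\<Sum>c\<in>sumset d N b. \<Sum>i\<in>{i \<in> tuples d N. (\<Sum>k=1..d. b (i k)) = c}. 1)"
    unfolding sumset_eq by (simp only: card_eq_sum) (rule sum.image_gen[OF finite_tuples])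
  then show ?thesis
    by (simp add: rep_def card_tuples)
qed

lemma rep_0: "rep 0 N b c = of_bool (c = 0)"
  by (auto simp: rep_def tuples_def)

text \<open>Splitting off the last summand exhibits the convolution to which
  \<open>weak_convolution_le\<close> applies.\<close>

lemma rep_Suc: "rep (Suc d) N b c = (\<Sum>i=1..N. rep d N b (c - b i))"
proof -
  let ?G = "\<lambda>i. {g \<in> tuples d N. (\<Sum>k=1..d. b (g k)) = c - b i}"
  let ?F = "{f \<in> tuples (Suc d) N. (\<Sum>k=1..Suc d. b (f k)) = c}"
  have "bij_betw (\<lambda>(i, g). g(Suc d := i)) (Sigma {1..N} ?G) ?F"
  \<comment> \<open>Position \<open>Suc d\<close> is reset to \<open>undefined\<close>, since a
    shortened tuple must take the default value outside \<open>{1..d}\<close>.\<close>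
  proof (rule bij_betw_byWitness[where f' = "\<lambda>f. (f (Suc d), f(Suc d := undefined))"])
    have ins: "{1..Suc d} = insert (Suc d) {1..d}"
      by auto
    have same: "(\<Sum>k=1..d. b ((g(Suc d := i)) k)) = (\<Sum>k=1..d. b (g k))" for g i
      by (intro sum.cong) auto
    show "(\<lambda>(i, g). g(Suc d := i)) ` Sigma {1..N} ?G \<subseteq> ?F"
    proof clarify
      fix i g assume "i \<in> {1..N}" "g \<in> tuples d N" "(\<Sum>k=1..d. b (g k)) = c - b i"
      moreover from this have "g(Suc d := i) \<in> tuples (Suc d) N"
        unfolding tuples_def ins by (intro PiE_fun_upd)
      ultimately show "g(Suc d := i) \<in> tuples (Suc d) N \<and> (\<Sum>k=1..Suc d. b ((g(Suc d := i)) k)) = c"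
        using same[of g i] by simp
    qed
    show "(\<lambda>f. (f (Suc d), f(Suc d := undefined))) ` ?F \<subseteq> Sigma {1..N} ?G"
    proof (rule image_subsetI)
      fix f assume f: "f \<in> ?F"
      then have "f(Suc d := undefined) \<in> tuples d N"
        unfolding tuples_def ins by (intro fun_upd_in_PiE) auto
      moreover have "f (Suc d) \<in> {1..N}"
        using f by (auto simp: tuples_def dest: PiE_mem[of _ _ _ "Suc d"])
      moreover have "(\<Sum>k=1..d. b ((f(Suc d := undefined)) k)) = c - b (f (Suc d))"
        using f same[of f undefined] by auto
      ultimately show "(f (Suc d), f(Suc d := undefined)) \<in> Sigma {1..N} ?G"
        by simp
    qed
    show "\<forall>x\<in>Sigma {1..N} ?G.
        (\<lambda>f. (f (Suc d), f(Suc d := undefined))) ((\<lambda>(i, g). g(Suc d := i)) x) = x"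
    proof
      fix x assume "x \<in> Sigma {1..N} ?G"
      then obtain i g where x: "x = (i, g)" and g: "g \<in> tuples d N"
        by auto
      have "g (Suc d) = undefined"
        using g unfolding tuples_def by (rule PiE_arb) simp
      then show "(\<lambda>f. (f (Suc d), f(Suc d := undefined))) ((\<lambda>(i, g). g(Suc d := i)) x) = x"
        by (simp add: x fun_eq_iff)
    qed
  qed auto
  then have "card ?F = card (Sigma {1..N} ?G)"
    by (rule bij_betw_same_card[symmetric])
  also have "\<dots> = (\<Sum>i=1..N. card (?G i))"
    by (intro card_SigmaI) (auto simp: finite_tuples)
  finally show ?thesis
    by (simp add: rep_def)
qed

text \<open>Cutting a solution in half gives two \<open>d\<close>-tuples with equal sums; grouping
  such pairs by their sum turns the count into a second moment.\<close>

lemma solution_count_eq: "solution_count d N b = (\<Sum>c\<in>sumset d N b. rep d N b c ^ 2)"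
proof -
  let ?s = "\<lambda>f. \<Sum>k=1..d. b (f k)"
  let ?X = "{(f, g). f \<in> tuples d N \<and> g \<in> tuples d N \<and> ?s f = ?s g}"
  let ?I = "{i \<in> tuples (2 * d) N. (\<Sum>k=1..d. b (i k)) = (\<Sum>k=d+1..2*d. b (i k))}"
  let ?join = "\<lambda>(f, g) k. if k \<le> d then f k else if k \<le> 2 * d then g (k - d) else undefined"
  have finX: "finite ?X"
    by (rule finite_subset[of _ "tuples d N \<times> tuples d N"]) (auto simp: finite_tuples)
  have shift: "(\<Sum>k=d+1..2*d. h k) = (\<Sum>k=1..d. h (k + d))" for h :: "nat \<Rightarrow> real"
    using sum.shift_bounds_cl_nat_ivl[of h 1 d d] by (simp add: mult_2 add.commute)
  have "bij_betw (\<lambda>i. (restrict i {1..d}, restrict (\<lambda>k. i (k + d)) {1..d})) ?I ?X"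
  proof (rule bij_betw_byWitness[where f' = ?join])
    show "\<forall>i\<in>?I. ?join (restrict i {1..d}, restrict (\<lambda>k. i (k + d)) {1..d}) = i"
      by (auto simp: tuples_def PiE_iff extensional_def fun_eq_iff)
    show "\<forall>x\<in>?X. (restrict (?join x) {1..d}, restrict (\<lambda>k. ?join x (k + d)) {1..d}) = x"
      by (auto simp: tuples_def PiE_iff extensional_def fun_eq_iff)
    show "(\<lambda>i. (restrict i {1..d}, restrict (\<lambda>k. i (k + d)) {1..d})) ` ?I \<subseteq> ?X"
      unfolding shift by (auto simp: tuples_def PiE_iff)
    show "?join ` ?X \<subseteq> ?I"
    proof
      fix i assume "i \<in> ?join ` ?X"
      then obtain f g where fg: "f \<in> tuples d N" "g \<in> tuples d N" "?s f = ?s g" and i: "i = ?join (f, g)"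
        by auto
      have "i k \<in> {1..N}" if "k \<in> {1..2 * d}" for k
      proof (cases "k \<le> d")
        case True
        then show ?thesis
          using fg(1) that unfolding i tuples_def by (auto dest!: PiE_mem[of _ _ _ k])
      next
        case False
        then show ?thesis
          using fg(2) that unfolding i tuples_def by (auto dest!: PiE_mem[of _ _ _ "k - d"])
      qed
      moreover have "i k = undefined" if "k \<notin> {1..2 * d}" for k
        using fg(1) that unfolding i tuples_def by (auto simp: PiE_iff extensional_def)
      ultimately have "i \<in> tuples (2 * d) N"
        unfolding tuples_def by (intro PiE_I)
      then show "i \<in> ?I"
        unfolding shift using fg(3) by (simp add: i)
    qed
  qed
  then have "solution_count d N b = card ?X"
    unfolding solution_count_def by (rule bij_betw_same_card)
  also have "\<dots> = (\<Sum>c\<in>(\<lambda>(f, g). ?s f) ` ?X. \<Sum>x\<in>{x\<in>?X. (\<lambda>(f, g). ?s f) x = c}. 1)"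
    by (simp only: card_eq_sum) (rule sum.image_gen[OF finX])
  also have "\<dots> = (\<Sum>c\<in>sumset d N b. rep d N b c ^ 2)"
  proof (rule sum.cong)
    show "(\<lambda>(f, g). ?s f) ` ?X = sumset d N b"
      by (force simp: sumset_eq)
    fix c
    have "{x\<in>?X. (\<lambda>(f, g). ?s f) x = c}
        = {i \<in> tuples d N. ?s i = c} \<times> {i \<in> tuples d N. ?s i = c}"
      by auto
    then show "(\<Sum>x\<in>{x\<in>?X. (\<lambda>(f, g). ?s f) x = c}. 1) = rep d N b c ^ 2"
      by (simp add: rep_def power2_eq_square card_cartesian_product)
  qed
  finally show ?thesis .
qed

section \<open>Exponents and the induction on the number of summands\<close>

lemma beta_Suc: "3 * \<beta> (Suc d) = 3 * real d - 1 + 2 * 2 powr (- real d)"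
proof -
  have "- real (Suc d) = - real d + - 1"
    by simp
  then have "2 powr (- real (Suc d)) = 2 powr (- real d) * 2 powr (- 1)"
    by (simp only: powr_add)
  also have "\<dots> = 2 powr (- real d) / 2"
    by (simp add: powr_minus_divide)
  finally show ?thesis
    by (simp add: \<beta>_def field_simps)
qed

text \<open>The level \<open>N powr balance d\<close>, where \<open>balance d = d - \<alpha> d\<close>, is the one at which the two estimates
  for the level sets of \<open>rep d N b\<close> agree.\<close>
definition balance :: "nat \<Rightarrow> real" where
  "balance d = real d - 2 + 2 * 2 powr (- real d)"

text \<open>Ensures that the height \<open>N powr balance d\<close> is at least 1 for
  \<open>N \<ge> 1\<close>. For \<open>d = 0\<close> and \<open>d = 1\<close> the power of 2 exactly
  compensates \<open>d - 2\<close>.\<close>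

lemma balance_nonneg: "balance d \<ge> 0"
proof (cases "d \<le> 1")
  case True
  then consider "d = 0" | "d = 1"
    by linarith
  then show ?thesis
    by cases (auto simp: balance_def powr_minus_divide)
next
  case False
  then show ?thesis
    by (simp add: balance_def)
qed

text \<open>At \<open>W = N powr balance d\<close> both terms of \<open>weak_convolution_le\<close>
  have the exponent \<open>3 * \<beta> (Suc d)\<close>. The condition \<open>N \<ge> 1\<close>
  excludes \<open>0 powr 0 = 0\<close>, for which the case \<open>d = 0\<close> would fail.\<close>

lemma rep_weak_bound:
  "\<exists>K\<ge>0. \<forall>N b. \<forall>\<tau>>0. strictly_convex_seq N b \<longrightarrow> N \<ge> 1 \<longrightarrow>
     real (card {c. \<tau> \<le> real (rep d N b c)}) * \<tau> ^ 3 \<le> K * real N powr (3 * \<beta> d)"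
proof (induction d)
  case 0
  \<comment> \<open>For \<open>d = 0\<close> there is only the empty sum, represented once, and
    \<open>3 * \<beta> 0 = 0\<close>, so the constant 1 serves.\<close>
  have "real (card {c. \<tau> \<le> real (rep 0 N b c)}) * \<tau> ^ 3 \<le> 1 * real N powr (3 * \<beta> 0)"
    if "\<tau> > 0" "N \<ge> 1" for N \<tau> and b :: "nat \<Rightarrow> real"
  proof (cases "\<tau> \<le> 1")
    case True
    have "{c. \<tau> \<le> real (rep 0 N b c)} = {0}"
      using True \<open>\<tau> > 0\<close> by (auto simp: rep_0 of_bool_def split: if_splits)
    then show ?thesis
      using True that by (simp add: \<beta>_def power_le_one)
  next
    case False
    then have "{c. \<tau> \<le> real (rep 0 N b c)} = {}"
      by (auto simp: rep_0 of_bool_def split: if_splits)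
    then show ?thesis
      by simp
  qed
  then show ?case
    by (intro exI[of _ 1]) auto
next
  case (Suc d)
  then obtain K where "K \<ge> 0" and K: "\<And>N b \<tau>. \<tau> > 0 \<Longrightarrow> strictly_convex_seq N b \<Longrightarrow> N \<ge> 1 \<Longrightarrow>
      real (card {c. \<tau> \<le> real (rep d N b c)}) * \<tau> ^ 3 \<le> K * real N powr (3 * \<beta> d)"
    by blast
  \<comment> \<open>The 1 comes from the mass term and \<open>8 * K ^ 2\<close> from the weak term,
    so the constant depends on \<open>d\<close> alone.\<close>
  define L where "L = 1327104000 * (1 + 8 * K ^ 2)"
  have "real (card {c. \<tau> \<le> real (rep (Suc d) N b c)}) * \<tau> ^ 3 \<le> L * real N powr (3 * \<beta> (Suc d))"
    if "\<tau> > 0" and b: "strictly_convex_seq N b" and N: "N \<ge> 1" for N b \<tau>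
  proof -
    define n where "n = real N"
    have n: "n \<ge> 1"
      using N by (simp add: n_def)
    define W where "W = n powr balance d"
    have W: "W \<ge> 1"
      unfolding W_def using n balance_nonneg by (rule ge_one_powr_ge_zero)
    have "real (card {c. \<tau> \<le> real (\<Sum>i=1..N. rep d N b (c - b i))}) * \<tau> ^ 3
        \<le> 1327104000 * real N * ((n ^ d) ^ 2 * W + 8 * (K * n powr (3 * \<beta> d)) ^ 2 / W ^ 3)"
    proof (rule weak_convolution_le[OF _ _ _ W b \<open>\<tau> > 0\<close>])
      show "finite {a. rep d N b a > 0}"
        by (simp add: Collect_rep_pos finite_sumset)
      show "(\<Sum>a | rep d N b a > 0. real (rep d N b a)) \<le> n ^ d"
        unfolding Collect_rep_pos by (simp add: sum_rep n_def flip: of_nat_sum)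
      show "real (card {a. k \<le> rep d N b a}) * real k ^ 3 \<le> K * n powr (3 * \<beta> d)" if "k \<ge> 1" for k
        using K[of "real k" N b] that b N by (simp add: n_def)
    qed
    also have "\<dots> = 1327104000 * (n * ((n ^ d) ^ 2 * W)
        + 8 * K ^ 2 * (n * ((n powr (3 * \<beta> d)) ^ 2 / W ^ 3)))"
      by (simp add: n_def power_mult_distrib algebra_simps)
    also have "n * ((n ^ d) ^ 2 * W) = n powr (3 * \<beta> (Suc d))"
    proof -
      have "n * ((n ^ d) ^ 2 * W) = n powr 1 * ((n powr real d) powr 2 * n powr balance d)"
        using n by (simp add: W_def powr_realpow)
      also have "\<dots> = n powr (1 + (real d * 2 + balance d))"
        by (simp only: powr_add powr_powr)
      also have "1 + (real d * 2 + balance d) = 3 * \<beta> (Suc d)"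
        unfolding beta_Suc balance_def by simp
      finally show ?thesis .
    qed
    also have "n * ((n powr (3 * \<beta> d)) ^ 2 / W ^ 3) = n powr (3 * \<beta> (Suc d))"
    proof -
      have "n * ((n powr (3 * \<beta> d)) ^ 2 / W ^ 3)
          = n powr 1 * ((n powr (3 * \<beta> d)) powr 2 / (n powr balance d) powr 3)"
        using n by (simp add: W_def)
      also have "\<dots> = n powr (1 + (3 * \<beta> d * 2 - balance d * 3))"
        by (simp only: powr_add powr_powr powr_diff)
      also have "1 + (3 * \<beta> d * 2 - balance d * 3) = 3 * \<beta> (Suc d)"
        unfolding beta_Suc unfolding balance_def \<beta>_def by (simp add: algebra_simps)
      finally show ?thesis .
    qed
    also have "1327104000 * (n powr (3 * \<beta> (Suc d)) + 8 * K ^ 2 * n powr (3 * \<beta> (Suc d)))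
        = L * n powr (3 * \<beta> (Suc d))"
      by (simp add: L_def algebra_simps)
    finally show ?thesis
      by (simp add: rep_Suc n_def)
  qed
  moreover have "L \<ge> 0"
    by (simp add: L_def)
  ultimately show ?case
    by blast
qed

section \<open>Additive energy, size of the sumset and ordered multiplicities\<close>

lemma solution_count_bound:
  assumes "d > 0"
  shows "\<exists>K>0. \<forall>N b. strictly_convex_seq N b \<longrightarrow>
     real (solution_count d N b) \<le> K * real N powr (2 * real d - \<alpha> d)"
proof -
  obtain K where "K \<ge> 0" and K: "\<And>N b \<tau>. \<tau> > 0 \<Longrightarrow> strictly_convex_seq N b \<Longrightarrow> N \<ge> 1 \<Longrightarrow>
      real (card {c. \<tau> \<le> real (rep d N b c)}) * \<tau> ^ 3 \<le> K * real N powr (3 * \<beta> d)"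
    using rep_weak_bound[of d] by blast
  define L where "L = 16 * (1 + 2 * K)"
  have "real (solution_count d N b) \<le> L * real N powr (2 * real d - \<alpha> d)"
    if b: "strictly_convex_seq N b" for N b
  proof (cases "N = 0")
    \<comment> \<open>Since \<open>0 powr x = 0\<close>, the count itself has to vanish;
      \<open>d > 0\<close> leaves no tuples.\<close>
    case True
    then have "tuples (2 * d) N = {}"
      using \<open>d > 0\<close> by (auto simp: tuples_def PiE_eq_empty_iff)
    then show ?thesis
      using True by (simp add: solution_count_def)
  next
    case False
    define n where "n = real N"
    have n: "n \<ge> 1"
      using False by (simp add: n_def)
    \<comment> \<open>The height from the induction also equalises the two contributions to the
      second moment: both become \<open>n powr (2 * real d - \<alpha> d)\<close>.\<close>
    define W where "W = n powr balance d"
    have W: "W \<ge> 1"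
      unfolding W_def using n balance_nonneg by (rule ge_one_powr_ge_zero)
    have "(\<Sum>a | rep d N b a > 0. real (rep d N b a) ^ 2)
        \<le> 16 * (n ^ d * W + 2 * (K * n powr (3 * \<beta> d)) / W)"
    proof (rule second_moment_le[OF _ _ _ W])
      show "finite {a. rep d N b a > 0}"
        by (simp add: Collect_rep_pos finite_sumset)
      show "(\<Sum>a | rep d N b a > 0. real (rep d N b a)) \<le> n ^ d"
        unfolding Collect_rep_pos by (simp add: sum_rep n_def flip: of_nat_sum)
      show "real (card {a. k \<le> rep d N b a}) * real k ^ 3 \<le> K * n powr (3 * \<beta> d)" if "k \<ge> 1" for k
        using K[of "real k" N b] that b False by (simp add: n_def)
    qed
    also have "n ^ d * W = n powr (2 * real d - \<alpha> d)"
      using n by (simp add: W_def balance_def \<alpha>_def algebra_simps flip: powr_realpow powr_add)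
    also have "2 * (K * n powr (3 * \<beta> d)) / W = 2 * K * n powr (3 * \<beta> d - balance d)"
      by (simp add: W_def powr_diff)
    also have "3 * \<beta> d - balance d = 2 * real d - \<alpha> d"
      by (simp add: balance_def \<alpha>_def \<beta>_def algebra_simps)
    finally show ?thesis
      by (simp add: solution_count_eq Collect_rep_pos L_def n_def algebra_simps)
  qed
  moreover have "L > 0"
    using \<open>K \<ge> 0\<close> by (simp add: L_def)
  ultimately show ?thesis
    by blast
qed

text \<open>Cauchy--Schwarz for \<open>rep\<close> on its support: the first moment is
  \<open>N ^ d\<close>, the second is the solution count.\<close>

lemma power_le_card_sumset_mult_solution_count:
  "real N ^ (2 * d) \<le> real (card (sumset d N b)) * real (solution_count d N b)"
proof -
  have "real N ^ (2 * d) = (\<Sum>c\<in>sumset d N b. real (rep d N b c)) ^ 2"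
    by (simp add: sum_rep power_mult mult.commute flip: of_nat_sum)
  also have "\<dots> \<le> (\<Sum>c\<in>sumset d N b. real (rep d N b c) ^ 2) * card (sumset d N b)"
    by (rule sum_squared_le_sum_of_squares)
  finally show ?thesis
    by (simp add: solution_count_eq mult.commute)
qed

lemma card_sumset_ge:
  assumes "d > 0" "K > 0" and K: "real (solution_count d N b) \<le> K * real N powr (2 * real d - \<alpha> d)"
  shows "real (card (sumset d N b)) \<ge> inverse K * real N powr \<alpha> d"
proof (cases "N = 0")
  case False
  let ?p = "real N powr (2 * real d - \<alpha> d)"
  have "?p > 0"
    using False by simp
  have "?p * real N powr \<alpha> d = real N ^ (2 * d)"
    using False by (simp flip: powr_add powr_realpow)
  also have "\<dots> \<le> real (card (sumset d N b)) * (K * ?p)"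
    by (rule order_trans[OF power_le_card_sumset_mult_solution_count])
      (use K in \<open>auto intro: mult_left_mono\<close>)
  also have "\<dots> = ?p * (K * real (card (sumset d N b)))"
    by simp
  finally have "real N powr \<alpha> d \<le> K * real (card (sumset d N b))"
    using \<open>?p > 0\<close> mult_le_cancel_left_pos by blast
  then show ?thesis
    using \<open>K > 0\<close> by (simp add: field_simps)
qed simp

text \<open>The first \<open>t\<close> enumerated sums are represented at least as often as
  \<open>c t\<close>, so the level set at that height has at least \<open>t\<close> elements; the
  weak bound and a cube root finish.\<close>

lemma \<nu>_enumeration_le:
  assumes c: "decreasing_enumeration d N b c" and t: "1 \<le> t" "t \<le> card (sumset d N b)"
    and C: "1 \<le> C" "K \<le> C"
    and K: "\<And>\<tau>. \<tau> > 0 \<Longrightarrow>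
      real (card {c. \<tau> \<le> real (rep d N b c)}) * \<tau> ^ 3 \<le> K * real N powr (3 * \<beta> d)"
  shows "\<nu> d N b (c t) \<le> C * real N powr \<beta> d * real t powr (- 1 / 3)"
proof -
  define \<tau> where "\<tau> = real (rep d N b (c t))"
  define y where "y = C * real N powr \<beta> d * real t powr (- 1 / 3)"
  have bij: "bij_betw c {1..card (sumset d N b)} (sumset d N b)"
    using c by (simp add: decreasing_enumeration_def)
  have "c t \<in> sumset d N b"
    using bij_betwE[OF bij] t by auto
  then have \<tau>: "\<tau> > 0"
    by (simp add: \<tau>_def rep_pos_iff)
  have "{c'. \<tau> \<le> real (rep d N b c')} \<subseteq> sumset d N b"
    using \<tau> rep_pos_iff[of d N b] by fastforce
  then have fin: "finite {c'. \<tau> \<le> real (rep d N b c')}"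
    using finite_sumset finite_subset by blast
  have "c ` {1..t} \<subseteq> {c'. \<tau> \<le> real (rep d N b c')}"
  proof
    fix x assume "x \<in> c ` {1..t}"
    then obtain s where s: "1 \<le> s" "s \<le> t" "x = c s"
      by auto
    then have "\<nu> d N b (c t) \<le> \<nu> d N b (c s)"
      using c t by (simp add: decreasing_enumeration_def)
    then show "x \<in> {c'. \<tau> \<le> real (rep d N b c')}"
      by (simp add: s \<nu>_def rep_def \<tau>_def divide_le_cancel)
  qed
  then have "card (c ` {1..t}) \<le> card {c'. \<tau> \<le> real (rep d N b c')}"
    by (rule card_mono[OF fin])
  moreover have "inj_on c {1..t}"
    by (rule inj_on_subset[OF bij_betw_imp_inj_on[OF bij]]) (use t in auto)
  then have "card (c ` {1..t}) = t"
    by (simp add: card_image)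
  ultimately have "real t * \<tau> ^ 3 \<le> real (card {c'. \<tau> \<le> real (rep d N b c')}) * \<tau> ^ 3"
    using \<tau> by (intro mult_right_mono) auto
  also have "\<dots> \<le> K * real N powr (3 * \<beta> d)"
    by (rule K[OF \<tau>])
  \<comment> \<open>The constant is cubed because \<open>C\<close> is a factor of \<open>y\<close>;
    \<open>1 \<le> C\<close> gives \<open>K \<le> C \<le> C ^ 3\<close>.\<close>
  also have "\<dots> \<le> C ^ 3 * real N powr (3 * \<beta> d)"
    using C self_le_power[of C 3] by (intro mult_right_mono) auto
  also have "\<dots> = real t * y ^ 3"
  proof -
    have cube: "(x powr a) ^ 3 = x powr (a * 3)" for x a :: real
      by (simp only: powr_powr[symmetric]) simp
    have "(real N powr \<beta> d) ^ 3 = real N powr (3 * \<beta> d)"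
      by (simp add: cube mult.commute)
    moreover have "(real t powr (- 1 / 3)) ^ 3 = 1 / real t"
      using t unfolding cube by (simp add: powr_minus_divide)
    ultimately show ?thesis
      using t by (simp add: y_def power_mult_distrib)
  qed
  finally have "\<tau> ^ 3 \<le> y ^ 3"
    using t by simp
  moreover have "y \<ge> 0"
    using C by (simp add: y_def)
  ultimately have "\<tau> \<le> y"
    using power_mono_iff[of \<tau> y 3] \<tau> by simp
  moreover have "\<nu> d N b (c t) \<le> \<tau>"
    unfolding \<nu>_def \<tau>_def rep_def by (simp add: divide_le_eq mult_left_le fact_ge_1 mult_le_cancel_left1)
  ultimately show ?thesis
    by (simp add: y_def)
qed

theorem theorem1:
  fixes d :: nat
  assumes "d \<ge> 2"
  shows "\<exists>C>0. \<forall>(N::nat) (b::nat \<Rightarrow> real). strictly_convex_seq N b \<longrightarrow>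
    real (card (sumset d N b)) \<ge> inverse C * real N powr \<alpha> d \<and>
    (\<forall>c. decreasing_enumeration d N b c \<longrightarrow>
       (\<forall>t::nat. 1 \<le> t \<and> t \<le> card (sumset d N b) \<longrightarrow>
          \<nu> d N b (c t) \<le> C * real N powr \<beta> d * real t powr (- 1 / 3))) \<and>
    real (solution_count d N b) \<le> C * real N powr (2 * real d - \<alpha> d) \<and>
    C * real N powr (2 * real d - \<alpha> d)
      = C * real N powr (2 * real d - 2 + 2 powr (- real d + 1))"
proof -
  have "d > 0"
    using assms by simp
  obtain K1 where K1: "\<And>N b \<tau>. \<tau> > 0 \<Longrightarrow> strictly_convex_seq N b \<Longrightarrow> N \<ge> 1 \<Longrightarrow>
      real (card {c. \<tau> \<le> real (rep d N b c)}) * \<tau> ^ 3 \<le> K1 * real N powr (3 * \<beta> d)"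
    using rep_weak_bound[of d] by blast
  obtain K2 where K2: "\<And>N b. strictly_convex_seq N b \<Longrightarrow>
      real (solution_count d N b) \<le> K2 * real N powr (2 * real d - \<alpha> d)"
    using solution_count_bound[OF \<open>d > 0\<close>] by blast
  \<comment> \<open>The 1 makes \<open>C\<close> positive and at most its own cube. One
    \<open>C\<close> serves throughout, as (i) inherits the constant of (iii).\<close>
  define C where "C = max 1 (max K1 K2)"
  have C: "1 \<le> C" "K1 \<le> C" "K2 \<le> C"
    by (auto simp: C_def)
  show ?thesis
  proof (intro exI[of _ C] conjI allI impI)
    fix N and b :: "nat \<Rightarrow> real"
    assume b: "strictly_convex_seq N b"
    have "real (solution_count d N b) \<le> K2 * real N powr (2 * real d - \<alpha> d)"
      by (rule K2[OF b])
    also have "\<dots> \<le> C * real N powr (2 * real d - \<alpha> d)"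
      using C by (intro mult_right_mono) auto
    finally show sol: "real (solution_count d N b) \<le> C * real N powr (2 * real d - \<alpha> d)" .
    show "inverse C * real N powr \<alpha> d \<le> real (card (sumset d N b))"
      by (rule card_sumset_ge[OF \<open>d > 0\<close> _ sol]) (use C in simp)
    have "2 powr (- real d + 1) = 2 * 2 powr (- real d)"
      unfolding powr_add by simp
    then show "C * real N powr (2 * real d - \<alpha> d)
      = C * real N powr (2 * real d - 2 + 2 powr (- real d + 1))"
      by (simp add: \<alpha>_def algebra_simps)
    fix c t
    assume c: "decreasing_enumeration d N b c" and t: "1 \<le> t \<and> t \<le> card (sumset d N b)"
    \<comment> \<open>\<open>K1\<close> is available only for \<open>N \<ge> 1\<close>; for
      \<open>N = 0\<close> the sumset is empty and admits no \<open>t\<close>.\<close>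
    have "N \<noteq> 0"
    proof
      assume "N = 0"
      then have "sumset d N b = {}"
        using \<open>d > 0\<close> by (auto simp: sumset_eq tuples_def PiE_eq_empty_iff)
      then show False
        using t by auto
    qed
    then show "\<nu> d N b (c t) \<le> C * real N powr \<beta> d * real t powr (- 1 / 3)"
      using t by (intro \<nu>_enumeration_le[OF c _ _ C(1,2)] K1 b) auto
  qed (use C in auto)
qed

end
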